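(* Let $X=(X_1,X_2)$ be bivariate log-normal, $X_i=\exp(Z_i)$ with $Z\sim\mathcal{N}_2(\mu,A)$, where $\mu\in\mathbb{R}^2$ and $A$ is symmetric positive definite with inverse $B=A^{-1}$. Put $b_i=B_{1i}+B_{2i}$ for $i=1,2$, and assume $b_2<0$. For $\alpha\in(0,1)$ let $q_\alpha(u_1,u_2)$ denote the $\alpha$-quantile of $u_1X_1+u_2X_2$. Then for every $t_1\in(0,1)$, $$q_\alpha(t_1,1-t_1)\sim k_\alpha\cdot t_1\quad\text{as }\alpha\to0,\qquad k_\alpha=q_\alpha(1,0).$$
   Context: $q_\alpha(u)=\inf\{y\in\mathbb{R}:P(u_1X_1+u_2X_2\le y)\ge\alpha\}$. The notation $f(\alpha)\sim g(\alpha)$ as $\alpha\to0$ means $f(\alpha)/g(\alpha)\to1$. *)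

theory Defs
  imports "HOL-Probability.Probability"
begin

definition pos_def_matrix :: "real ^ 'n ^ 'n \<Rightarrow> bool" where
  "pos_def_matrix A \<longleftrightarrow> transpose A = A \<and> (\<forall>x. x \<noteq> 0 \<longrightarrow> 0 < x \<bullet> (A *v x))"

(* Meant for covariance matrices A that are symmetric positive definite. *)
definition multivariate_normal_density ::
    "real ^ 'n \<Rightarrow> real ^ 'n ^ 'n \<Rightarrow> real ^ 'n \<Rightarrow> real" where
  "multivariate_normal_density \<mu> A x =
     exp (- ((x - \<mu>) \<bullet> (matrix_inv A *v (x - \<mu>))) / 2) / sqrt ((2 * pi) ^ CARD('n) * det A)"

definition multivariate_normal ::
    "'a measure \<Rightarrow> ('a \<Rightarrow> real ^ 'n) \<Rightarrow> real ^ 'n \<Rightarrow> real ^ 'n ^ 'n \<Rightarrow> bool" where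
  "multivariate_normal M Z \<mu> A \<longleftrightarrow>
     distributed M lborel Z (\<lambda>x. ennreal (multivariate_normal_density \<mu> A x))"

definition quantile :: "'a measure \<Rightarrow> ('a \<Rightarrow> real) \<Rightarrow> real \<Rightarrow> real" where
  "quantile M Y \<alpha> = Inf {y. measure M {\<omega> \<in> space M. Y \<omega> \<le> y} \<ge> \<alpha>}"

definition sum_quantile ::
    "'a measure \<Rightarrow> ('a \<Rightarrow> real ^ 2) \<Rightarrow> real \<Rightarrow> real \<Rightarrow> real \<Rightarrow> real" where
  "sum_quantile M X \<alpha> u\<^sub>1 u\<^sub>2 = quantile M (\<lambda>\<omega>. u\<^sub>1 * X \<omega> $ 1 + u\<^sub>2 * X \<omega> $ 2) \<alpha>"

end

theory Submission
  imports Defs "HOL-Real_Asymp.Real_Asymp"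
begin

text \<open>
  Regressing \<open>Z\<^sub>2\<close> on \<open>Z\<^sub>1\<close> has slope \<open>\<beta> = - B\<^sub>1\<^sub>2 / B\<^sub>2\<^sub>2\<close>, and \<open>b\<^sub>2 < 0\<close> says exactly that \<open>\<beta> > 1\<close>.
  So on the event that \<open>Z\<^sub>1\<close> is very small, \<open>Z\<^sub>2\<close> is typically smaller still, \<open>X\<^sub>2\<close> is negligible
  against \<open>X\<^sub>1\<close>, and the sum behaves like \<open>t\<^sub>1 X\<^sub>1\<close>. Quantitatively, for all \<open>h > 0\<close> and \<open>c\<close>,
  \<open>P(Z\<^sub>1 \<le> z) \<le> P(Z\<^sub>1 \<le> z + h, Z\<^sub>2 \<le> z + c)\<close> as soon as \<open>z\<close> is small enough. No marginal or
  conditional law is needed for this: translating the Gaussian density by \<open>(0, -w)\<close> shows that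
  dropping the part of the half-plane where the residual exceeds \<open>w\<close> loses at most half of its
  mass, and translating by \<open>h (1, \<beta>)\<close> doubles the mass again.
\<close>

section \<open>Positive definite matrices and their inverses\<close>

lemma pos_def_matrix_invertible:
  fixes A :: "real ^ 'n ^ 'n"
  assumes "pos_def_matrix A"
  shows "invertible A"
proof -
  have "x = 0" if "A *v x = 0" for x
    using assms that unfolding pos_def_matrix_def by (metis inner_zero_right less_irrefl)
  then show ?thesis
    using matrix_left_invertible_ker invertible_left_inverse by blast
qed

lemma pos_def_matrix_inv:
  fixes A :: "real ^ 'n ^ 'n"
  assumes "pos_def_matrix A"
  shows "pos_def_matrix (matrix_inv A)"
proof -
  let ?B = "matrix_inv A"
  have inv: "A ** ?B = mat 1" "?B ** A = mat 1"
    using someI_ex[OF pos_def_matrix_invertible[OF assms, unfolded invertible_def]]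
    by (simp_all add: matrix_inv_def)
  have sym: "transpose A = A" and pos: "\<And>x. x \<noteq> 0 \<Longrightarrow> 0 < x \<bullet> (A *v x)"
    using assms by (auto simp: pos_def_matrix_def)
  have "transpose ?B ** A = mat 1"
    using matrix_transpose_mul[of A ?B] by (simp add: inv sym)
  then have "transpose ?B = ?B"
    using matrix_mul_assoc[of "transpose ?B" A ?B] by (simp add: inv)
  moreover have "0 < x \<bullet> (?B *v x)" if "x \<noteq> 0" for x
  proof -
    have x: "A *v (?B *v x) = x"
      by (simp add: inv matrix_vector_mul_assoc)
    then have "?B *v x \<noteq> 0"
      using that by auto
    then show ?thesis
      using pos[of "?B *v x"] x by (simp add: inner_commute)
  qed
  ultimately show ?thesis
    by (simp add: pos_def_matrix_def)
qed

lemma pos_def_matrix_2D: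
  fixes B :: "real ^ 2 ^ 2"
  assumes "pos_def_matrix B"
  shows "B $ 2 $ 1 = B $ 1 $ 2" and "0 < B $ 2 $ 2" and "0 < det B"
proof -
  have "transpose B = B"
    using assms by (simp add: pos_def_matrix_def)
  from arg_cong[OF this, of "\<lambda>C. C $ 1 $ 2"] show sym: "B $ 2 $ 1 = B $ 1 $ 2"
    by (simp add: transpose_def)
  have pos: "0 < x \<bullet> (B *v x)" if "x \<noteq> 0" for x
    using assms that by (simp add: pos_def_matrix_def)
  have "axis 2 1 \<noteq> (0 :: real ^ 2)"
    by (simp add: axis_eq_0_iff)
  from pos[OF this] show B22: "0 < B $ 2 $ 2"
    by (simp add: inner_vec_def matrix_vector_mult_def sum_2 axis_def)
  \<comment> \<open>On this vector the quadratic form equals \<open>B $ 2 $ 2 * det B\<close>, so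
    the sign of the determinant follows from that of \<open>B $ 2 $ 2\<close>.\<close>
  let ?x = "vector [B $ 2 $ 2, - B $ 1 $ 2] :: real ^ 2"
  have "?x \<noteq> 0"
    using B22 by (simp add: vec_eq_iff forall_2)
  from pos[OF this] have "0 < B $ 2 $ 2 * det B"
    by (simp add: inner_vec_def matrix_vector_mult_def sum_2 det_2 sym algebra_simps)
  with B22 show "0 < det B"
    by (simp add: zero_less_mult_iff)
qed

section \<open>Lower-tail estimates for the bivariate Gaussian law\<close>

text \<open>Lebesgue measure is translation invariant and \<open>v\<close> carries \<open>S\<close>
  into \<open>T\<close>, so a pointwise comparison of the density at \<open>x\<close> and
  \<open>x + v\<close> integrates to a comparison of probabilities. It is applied below with
  \<open>c = 1/2\<close>.\<close>

lemma distributed_measure_le_translate: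
  fixes Z :: "'a \<Rightarrow> 'b :: euclidean_space" and f :: "'b \<Rightarrow> real"
  assumes "prob_space M" and Z: "distributed M lborel Z (\<lambda>x. ennreal (f x))"
    and S [measurable]: "S \<in> sets borel" and T [measurable]: "T \<in> sets borel"
    and "0 \<le> c" and ST: "\<And>x. x \<in> S \<Longrightarrow> x + v \<in> T \<and> f x \<le> c * f (x + v)"
  shows "measure M {\<omega> \<in> space M. Z \<omega> \<in> S} \<le> c * measure M {\<omega> \<in> space M. Z \<omega> \<in> T}"
proof -
  interpret prob_space M by fact
  have [measurable]: "(\<lambda>x. ennreal (f x)) \<in> borel_measurable borel"
    using distributed_borel_measurable[OF Z] by simp
  have eq: "emeasure M {\<omega> \<in> space M. Z \<omega> \<in> U} = (\<integral>\<^sup>+x. ennreal (f x) * indicator U x \<partial>lborel)"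
    if "U \<in> sets borel" for U
    using distributed_emeasure[OF Z, of U] that by (simp add: vimage_def Int_def conj_commute)
  have "(\<integral>\<^sup>+x. ennreal (f x) * indicator S x \<partial>lborel)
      \<le> (\<integral>\<^sup>+x. c * (ennreal (f (v + x)) * indicator T (v + x)) \<partial>lborel)"
  proof (rule nn_integral_mono)
    fix x
    show "ennreal (f x) * indicator S x \<le> c * (ennreal (f (v + x)) * indicator T (v + x))"
      using ST[of x] \<open>0 \<le> c\<close>
      by (auto simp: indicator_def add.commute ennreal_mult'[symmetric] intro!: ennreal_leI)
  qed
  also have "\<dots> = c * (\<integral>\<^sup>+x. ennreal (f (v + x)) * indicator T (v + x) \<partial>lborel)"
    by (rule nn_integral_cmult) measurable
  also have "(\<integral>\<^sup>+x. ennreal (f (v + x)) * indicator T (v + x) \<partial>lborel)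
      = (\<integral>\<^sup>+x. ennreal (f x) * indicator T x \<partial>distr lborel borel ((+) v))"
    by (subst nn_integral_distr) auto
  also have "\<dots> = (\<integral>\<^sup>+x. ennreal (f x) * indicator T x \<partial>lborel)"
    by (simp add: lborel_distr_plus)
  finally have "emeasure M {\<omega> \<in> space M. Z \<omega> \<in> S} \<le> c * emeasure M {\<omega> \<in> space M. Z \<omega> \<in> T}"
    by (simp add: eq)
  then show ?thesis
    using \<open>0 \<le> c\<close> by (simp add: emeasure_eq_measure ennreal_mult'[symmetric])
qed

lemma multivariate_normal_2_lower_tail:
  fixes Z :: "'a \<Rightarrow> real ^ 2"
  assumes "prob_space M" and A: "pos_def_matrix A" and Z: "multivariate_normal M Z \<mu> A"
    and b2: "matrix_inv A $ 1 $ 2 + matrix_inv A $ 2 $ 2 < 0" and "0 < h"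
  shows "\<forall>\<^sub>F z in at_bot. measure M {\<omega> \<in> space M. Z \<omega> $ 1 \<le> z}
    \<le> measure M {\<omega> \<in> space M. Z \<omega> $ 1 \<le> z + h \<and> Z \<omega> $ 2 \<le> z + c}"
proof -
  interpret prob_space M by fact
  define B where "B = matrix_inv A"
  define p where "p = multivariate_normal_density \<mu> A"
  note B = pos_def_matrix_2D[OF pos_def_matrix_inv[OF A], folded B_def]
  have p: "distributed M lborel Z (\<lambda>x. ennreal (p x))"
    using Z by (simp add: multivariate_normal_def p_def)
  have Z_borel: "Z \<in> borel_measurable M"
    using distributed_measurable[OF p] by simp
  have [measurable]: "(\<lambda>\<omega>. Z \<omega> $ i) \<in> borel_measurable M" for i
    using measurable_compose[OF Z_borel borel_measurable_nth] .
  \<comment> \<open>The ratio \<open>p (x + v) / p x\<close> is the exponential of half the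
    right-hand side of the condition below, so the condition says that this ratio is at least
    2.\<close>
  have translate: "p x \<le> 1/2 * p (x + v)"
    if "2 * ln 2 \<le> - (v \<bullet> (B *v v)) - 2 * (v \<bullet> (B *v (x - \<mu>)))" for x v
  proof -
    define Q where "Q y = y \<bullet> (B *v y)" for y
    have "Q (x + v - \<mu>) = Q (x - \<mu>) + 2 * (v \<bullet> (B *v (x - \<mu>))) + v \<bullet> (B *v v)"
      by (simp add: Q_def inner_vec_def matrix_vector_mult_def sum_2 B algebra_simps)
    then have "ln 2 - Q (x - \<mu>) / 2 \<le> - Q (x + v - \<mu>) / 2"
      using that by simp
    then have "exp (ln 2 + (- Q (x - \<mu>) / 2)) \<le> exp (- Q (x + v - \<mu>) / 2)"
      by simp
    then have "exp (- Q (x - \<mu>) / 2) \<le> 1/2 * exp (- Q (x + v - \<mu>) / 2)"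
      by (simp only: exp_add) simp
    moreover have "0 < sqrt ((2 * pi) ^ CARD(2) * det A)"
      using pos_def_matrix_2D[OF A] by simp
    ultimately show ?thesis
      unfolding p_def multivariate_normal_density_def B_def[symmetric] Q_def[symmetric]
      by (metis divide_right_mono less_imp_le times_divide_eq_right)
  qed
  define \<beta> where "\<beta> = - B $ 1 $ 2 / B $ 2 $ 2"
  \<comment> \<open>The regression residual. Two facts make it useful:
    \<open>B $ 2 $ 2 * L x\<close> is the second coordinate of \<open>B *v (x - \<mu>)\<close>, and
    \<open>L\<close> is constant along the direction \<open>(1, \<beta>)\<close>.\<close>
  define L where "L x = x $ 2 - \<mu> $ 2 - \<beta> * (x $ 1 - \<mu> $ 1)" for x :: "real ^ 2"
  have [measurable]: "L \<in> borel_measurable borel" "(\<lambda>\<omega>. L (Z \<omega>)) \<in> borel_measurable M"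
    unfolding L_def by measurable
  have "1 < \<beta>"
    using b2 B by (simp add: \<beta>_def B_def[symmetric] field_simps)
  \<comment> \<open>\<open>\<kappa>\<close> is \<open>1 / A\<^sub>1\<^sub>1\<close>, and \<open>B (1, \<beta>) = (\<kappa>, 0)\<close>\<close>
  define \<kappa> where "\<kappa> = det B / B $ 2 $ 2"
  have "0 < \<kappa>"
    using B by (simp add: \<kappa>_def)
  \<comment> \<open>chosen so that the translation by \<open>(0, -w)\<close> at least doubles the density where \<open>L > w\<close>\<close>
  define w where "w = sqrt (2 * ln 2 / B $ 2 $ 2)"
  have w: "0 < w" "w\<^sup>2 * B $ 2 $ 2 = 2 * ln 2"
    using B by (simp_all add: w_def)
  have half: "measure M {\<omega> \<in> space M. Z \<omega> $ 1 \<le> z}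
      \<le> 2 * measure M {\<omega> \<in> space M. Z \<omega> $ 1 \<le> z \<and> L (Z \<omega>) \<le> w}" for z
  proof -
    have sets: "{x \<in> space borel. x $ 1 \<le> z \<and> \<not> L x \<le> w} \<in> sets borel"
      "{x \<in> space borel. (x :: real ^ 2) $ 1 \<le> z} \<in> sets borel"
      by measurable
    have "measure M {\<omega> \<in> space M. Z \<omega> \<in> {x. x $ 1 \<le> z \<and> \<not> L x \<le> w}}
        \<le> 1/2 * measure M {\<omega> \<in> space M. Z \<omega> \<in> {x. x $ 1 \<le> z}}"
    proof (rule distributed_measure_le_translate[OF prob_space_axioms p,
          where v = "vector [0, - w]"])
      fix x assume "x \<in> {x. x $ 1 \<le> z \<and> \<not> L x \<le> w}"
      then have x: "x $ 1 \<le> z" "\<not> L x \<le> w"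
        by auto
      let ?v = "vector [0, - w] :: real ^ 2"
      \<comment> \<open>The cross term contributes \<open>2 * w * B $ 2 $ 2 * L x\<close>, which is
        at least \<open>4 * ln 2\<close> because \<open>L x > w\<close>. The quadratic term costs
        \<open>2 * ln 2\<close>, and \<open>2 * ln 2\<close> remains.\<close>
      have "?v \<bullet> (B *v (x - \<mu>)) = - (w * B $ 2 $ 2 * L x)"
        using B by (simp add: inner_vec_def matrix_vector_mult_def sum_2 L_def \<beta>_def field_simps)
      moreover have "?v \<bullet> (B *v ?v) = 2 * ln 2"
        using w(2) by (simp add: inner_vec_def matrix_vector_mult_def sum_2 power2_eq_square mult_ac)
      moreover have "2 * ln 2 \<le> w * B $ 2 $ 2 * L x"
        unfolding w(2)[symmetric] power2_eq_square
        using mult_left_mono[of w "L x" "w * B $ 2 $ 2"] w(1) B x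
        by (simp add: mult_ac)
      ultimately have "2 * ln 2 \<le> - (?v \<bullet> (B *v ?v)) - 2 * (?v \<bullet> (B *v (x - \<mu>)))"
        by linarith
      from translate[OF this] x show "x + ?v \<in> {x. x $ 1 \<le> z} \<and> p x \<le> 1/2 * p (x + ?v)"
        by simp
    qed (use sets in simp_all)
    moreover have "measure M ({\<omega> \<in> space M. Z \<omega> $ 1 \<le> z \<and> L (Z \<omega>) \<le> w}
          \<union> {\<omega> \<in> space M. Z \<omega> $ 1 \<le> z \<and> \<not> L (Z \<omega>) \<le> w})
        = measure M {\<omega> \<in> space M. Z \<omega> $ 1 \<le> z \<and> L (Z \<omega>) \<le> w}
          + measure M {\<omega> \<in> space M. Z \<omega> $ 1 \<le> z \<and> \<not> L (Z \<omega>) \<le> w}"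
    proof (rule finite_measure_Union)
      show "{\<omega> \<in> space M. Z \<omega> $ 1 \<le> z \<and> L (Z \<omega>) \<le> w}
          \<inter> {\<omega> \<in> space M. Z \<omega> $ 1 \<le> z \<and> \<not> L (Z \<omega>) \<le> w} = {}"
        by blast
    qed measurable
    moreover have "{\<omega> \<in> space M. Z \<omega> $ 1 \<le> z \<and> L (Z \<omega>) \<le> w}
          \<union> {\<omega> \<in> space M. Z \<omega> $ 1 \<le> z \<and> \<not> L (Z \<omega>) \<le> w} = {\<omega> \<in> space M. Z \<omega> $ 1 \<le> z}"
      by blast
    ultimately show ?thesis
      by simp
  qed
  \<comment> \<open>The first condition makes translation by \<open>(h, h * \<beta>)\<close> double
    the density wherever \<open>x $ 1 \<le> z\<close>. The second holds because its left side has
    slope \<open>\<beta> > 1\<close> in \<open>z\<close> and so falls faster than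
    \<open>z + c\<close> as \<open>z\<close> tends to minus infinity.\<close>
  have "\<forall>\<^sub>F z in at_bot. 2 * ln 2 \<le> - (h\<^sup>2 * \<kappa>) - 2 * (h * \<kappa>) * (z - \<mu> $ 1)"
    using \<open>0 < h\<close> \<open>0 < \<kappa>\<close> by real_asymp
  moreover have "\<forall>\<^sub>F z in at_bot. \<mu> $ 2 + w + \<beta> * (z + h - \<mu> $ 1) \<le> z + c"
    using \<open>1 < \<beta>\<close> by real_asymp
  ultimately show ?thesis
  proof eventually_elim
    case (elim z)
    have sets: "{x \<in> space borel. x $ 1 \<le> z \<and> L x \<le> w} \<in> sets borel"
      "{x \<in> space borel. (x :: real ^ 2) $ 1 \<le> z + h \<and> x $ 2 \<le> z + c} \<in> sets borel"
      by measurable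
    have "measure M {\<omega> \<in> space M. Z \<omega> \<in> {x. x $ 1 \<le> z \<and> L x \<le> w}}
        \<le> 1/2 * measure M {\<omega> \<in> space M. Z \<omega> \<in> {x. x $ 1 \<le> z + h \<and> x $ 2 \<le> z + c}}"
    proof (rule distributed_measure_le_translate[OF prob_space_axioms p,
          where v = "vector [h, h * \<beta>]"])
      fix x assume "x \<in> {x. x $ 1 \<le> z \<and> L x \<le> w}"
      then have x: "x $ 1 \<le> z" "L x \<le> w"
        by auto
      let ?v = "vector [h, h * \<beta>] :: real ^ 2"
      have "?v \<bullet> (B *v (x - \<mu>)) = h * \<kappa> * (x $ 1 - \<mu> $ 1)"
        using B by (simp add: inner_vec_def matrix_vector_mult_def sum_2 \<beta>_def \<kappa>_def det_2 field_simps)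
      moreover have "?v \<bullet> (B *v ?v) = h\<^sup>2 * \<kappa>"
        using B by (simp add: inner_vec_def matrix_vector_mult_def sum_2 \<beta>_def \<kappa>_def det_2 field_simps power2_eq_square)
      moreover have "h * \<kappa> * (x $ 1 - \<mu> $ 1) \<le> h * \<kappa> * (z - \<mu> $ 1)"
        using \<open>0 < h\<close> \<open>0 < \<kappa>\<close> x by (intro mult_left_mono) auto
      ultimately have "2 * ln 2 \<le> - (?v \<bullet> (B *v ?v)) - 2 * (?v \<bullet> (B *v (x - \<mu>)))"
        using elim(1) by linarith
      note translate[OF this]
      \<comment> \<open>The translation preserves \<open>L\<close>, so the bound
        \<open>L x \<le> w\<close> still controls the second coordinate of the translated point
        through its first one.\<close>
      moreover have "\<beta> * (x $ 1 + h - \<mu> $ 1) \<le> \<beta> * (z + h - \<mu> $ 1)"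
        using \<open>1 < \<beta>\<close> x by (intro mult_left_mono) auto
      then have "x $ 2 + h * \<beta> \<le> z + c"
        using elim(2) x by (simp add: L_def algebra_simps)
      ultimately show "x + ?v \<in> {x. x $ 1 \<le> z + h \<and> x $ 2 \<le> z + c} \<and> p x \<le> 1/2 * p (x + ?v)"
        using x by simp
    qed (use sets in simp_all)
    with half[of z] show ?case
      by simp
  qed
qed

text \<open>The density is positive everywhere, so a half-plane of probability zero would be
  Lebesgue null; but it contains a nonempty open set.\<close>

lemma multivariate_normal_2_halfspace_pos:
  fixes Z :: "'a \<Rightarrow> real ^ 2"
  assumes "prob_space M" and A: "pos_def_matrix A" and Z: "multivariate_normal M Z \<mu> A"
  shows "0 < measure M {\<omega> \<in> space M. Z \<omega> $ i \<le> z}"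
proof (rule ccontr)
  interpret prob_space M by fact
  let ?f = "\<lambda>x. ennreal (multivariate_normal_density \<mu> A x)" and ?H = "{x :: real ^ 2. x $ i \<le> z}"
  have p: "distributed M lborel Z ?f"
    using Z by (simp add: multivariate_normal_def)
  have [measurable]: "?f \<in> borel_measurable borel"
    using distributed_borel_measurable[OF p] by simp
  assume "\<not> 0 < measure M {\<omega> \<in> space M. Z \<omega> $ i \<le> z}"
  then have "emeasure M {\<omega> \<in> space M. Z \<omega> $ i \<le> z} = 0"
    by (simp add: emeasure_eq_measure not_less measure_le_0_iff)
  then have "(\<integral>\<^sup>+x. ?f x * indicator ?H x \<partial>lborel) = 0"
    using distributed_emeasure[OF p, of ?H] by (simp add: vimage_def Int_def conj_commute)
  then have "AE x in lborel. ?f x * indicator ?H x = 0"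
    by (subst (asm) nn_integral_0_iff_AE) auto
  moreover have "0 < multivariate_normal_density \<mu> A x" for x
    using pos_def_matrix_2D[OF A] by (simp add: multivariate_normal_density_def)
  ultimately have "AE x in lborel. x \<notin> ?H"
    by (auto simp: indicator_def ennreal_eq_0_iff not_less[symmetric] split: if_splits
        elim!: eventually_mono)
  then have "?H \<in> null_sets lborel"
    by (subst (asm) AE_iff_null_sets[symmetric]) auto
  then have "negligible ?H"
    by (simp add: negligible_iff_null_sets null_sets_completionI)
  moreover have "{x :: real ^ 2. x $ i < z} \<subseteq> ?H"
    by auto
  ultimately have "negligible {x :: real ^ 2. x $ i < z}"
    using negligible_subset by blast
  moreover have "open {x :: real ^ 2. x $ i < z}"
    by (intro open_Collect_less continuous_intros)
  moreover have "vec (z - 1) \<in> {x :: real ^ 2. x $ i < z}"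
    by simp
  ultimately show False
    using open_not_negligible by blast
qed

section \<open>Quantiles of positive variables and of their weighted sums\<close>

lemma mem_quantile_set_pos:
  fixes Y :: "'a \<Rightarrow> real"
  assumes "\<forall>\<omega>\<in>space M. 0 < Y \<omega>" and "0 < \<alpha>"
    and "\<alpha> \<le> measure M {\<omega> \<in> space M. Y \<omega> \<le> y}"
  shows "0 < y"
proof (rule ccontr)
  assume "\<not> 0 < y"
  then have "y < Y \<omega>" if "\<omega> \<in> space M" for \<omega>
    using assms(1) that by fastforce
  then have "{\<omega> \<in> space M. Y \<omega> \<le> y} = {}"
    by fastforce
  then have "measure M {\<omega> \<in> space M. Y \<omega> \<le> y} = 0"
    by (simp only: measure_empty)
  then show False
    using assms(2,3) by linarith
qed

text \<open>Positivity of \<open>Y\<close> and of \<open>\<alpha>\<close> makes 0 a lower bound of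
  the set defining the quantile, so \<open>Inf\<close> is a genuine lower bound there.\<close>

lemma quantile_le:
  assumes "\<forall>\<omega>\<in>space M. 0 < Y \<omega>" and "0 < \<alpha>"
    and "\<alpha> \<le> measure M {\<omega> \<in> space M. Y \<omega> \<le> y}"
  shows "quantile M Y \<alpha> \<le> y"
  unfolding quantile_def
proof (rule cInf_lower)
  show "bdd_below {y. \<alpha> \<le> measure M {\<omega> \<in> space M. Y \<omega> \<le> y}}"
    using mem_quantile_set_pos[OF assms(1,2)] by (intro bdd_belowI[of _ 0]) (simp add: less_imp_le)
qed (use assms(3) in simp)

text \<open>The witness \<open>y0\<close> shows that the set is nonempty, without which
  \<open>Inf\<close> on the reals would carry no information.\<close>

lemma le_quantile:
  assumes "\<alpha> \<le> measure M {\<omega> \<in> space M. Y \<omega> \<le> y0}"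
    and "\<And>y. \<alpha> \<le> measure M {\<omega> \<in> space M. Y \<omega> \<le> y} \<Longrightarrow> l \<le> y"
  shows "l \<le> quantile M Y \<alpha>"
  unfolding quantile_def by (rule cInf_greatest) (use assms in auto)

text \<open>The strict inequality yields a member of the quantile set below \<open>y\<close>, so it
  does not matter here whether the infimum is attained.\<close>

lemma (in finite_measure) le_measure_of_quantile_less:
  assumes [measurable]: "Y \<in> borel_measurable M"
    and "\<alpha> \<le> measure M {\<omega> \<in> space M. Y \<omega> \<le> y0}" and "quantile M Y \<alpha> < y"
  shows "\<alpha> \<le> measure M {\<omega> \<in> space M. Y \<omega> \<le> y}"
proof -
  obtain y' where "y' < y" "\<alpha> \<le> measure M {\<omega> \<in> space M. Y \<omega> \<le> y'}"
    using le_quantile[of \<alpha> M Y y0 y] assms(2,3) by (metis not_less)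
  moreover have "measure M {\<omega> \<in> space M. Y \<omega> \<le> y'} \<le> measure M {\<omega> \<in> space M. Y \<omega> \<le> y}"
    using \<open>y' < y\<close> by (intro finite_measure_mono) auto
  ultimately show ?thesis
    by linarith
qed

text \<open>A sandwich: positivity of \<open>V\<close> gives the lower bound \<open>s\<close> times
  the quantile of \<open>U\<close>, and \<open>dom\<close> gives the upper bound
  \<open>(1 + \<epsilon>) * s\<close> times that quantile for small \<open>\<alpha>\<close>.\<close>

lemma quantile_sum_asymp_equiv:
  fixes U V :: "'a \<Rightarrow> real"
  assumes "prob_space M" and [measurable]: "U \<in> borel_measurable M" "V \<in> borel_measurable M"
    and pos: "\<forall>\<omega>\<in>space M. 0 < U \<omega>" "\<forall>\<omega>\<in>space M. 0 < V \<omega>"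
    and tail: "\<And>y. 0 < y \<Longrightarrow> 0 < measure M {\<omega> \<in> space M. U \<omega> \<le> y}"
    and dom: "\<And>h c. 1 < h \<Longrightarrow> 0 < c \<Longrightarrow> \<forall>\<^sub>F y in at_right 0.
      measure M {\<omega> \<in> space M. U \<omega> \<le> y} \<le> measure M {\<omega> \<in> space M. U \<omega> \<le> y * h \<and> V \<omega> \<le> y * c}"
    and st: "0 < s" "0 < t"
  shows "(\<lambda>\<alpha>. quantile M (\<lambda>\<omega>. s * U \<omega> + t * V \<omega>) \<alpha>) \<sim>[at_right 0] (\<lambda>\<alpha>. quantile M U \<alpha> * s)"
  \<comment> \<open>The little-o form avoids dividing by the quantile of \<open>U\<close>, which is
    only shown to be nonnegative.\<close>
  unfolding asymp_equiv_altdef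
proof (rule landau_o.smallI)
  fix \<epsilon> :: real assume "0 < \<epsilon>"
  interpret prob_space M by fact
  let ?W = "\<lambda>\<omega>. s * U \<omega> + t * V \<omega>"
  have Wpos: "\<forall>\<omega>\<in>space M. 0 < ?W \<omega>"
    using pos st by (simp add: add_pos_pos)
  \<comment> \<open>Chosen so that \<open>s * h + t * c = (1 + \<epsilon>) * s\<close>, with the
    excess \<open>s * \<epsilon>\<close> shared equally by the two terms.\<close>
  define h c where "h = 1 + \<epsilon> / 2" and "c = s * \<epsilon> / (2 * t)"
  have "1 < h" "0 < c"
    using \<open>0 < \<epsilon>\<close> st by (simp_all add: h_def c_def)
  from dom[OF this] obtain y0 where "0 < y0" and y0: "\<And>y. 0 < y \<Longrightarrow> y < y0 \<Longrightarrow>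
      measure M {\<omega> \<in> space M. U \<omega> \<le> y} \<le> measure M {\<omega> \<in> space M. U \<omega> \<le> y * h \<and> V \<omega> \<le> y * c}"
    unfolding eventually_at_right_field by auto
  have sum_le: "measure M {\<omega> \<in> space M. U \<omega> \<le> y} \<le> measure M {\<omega> \<in> space M. ?W \<omega> \<le> (1 + \<epsilon>) * s * y}"
    if "0 < y" "y < y0" for y
  proof -
    have "s * u + t * v \<le> (1 + \<epsilon>) * s * y" if "u \<le> y * h" "v \<le> y * c" for u v
    proof -
      have "s * u + t * v \<le> s * (y * h) + t * (y * c)"
        using that st by (intro add_mono mult_left_mono) auto
      also have "\<dots> = (1 + \<epsilon>) * s * y"
        using st by (simp add: h_def c_def field_simps)
      finally show ?thesis .
    qed
    then have "measure M {\<omega> \<in> space M. U \<omega> \<le> y * h \<and> V \<omega> \<le> y * c}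
        \<le> measure M {\<omega> \<in> space M. ?W \<omega> \<le> (1 + \<epsilon>) * s * y}"
      by (intro finite_measure_mono) auto
    with y0[OF that] show ?thesis
      by linarith
  qed
  \<comment> \<open>For such \<open>\<alpha>\<close> the quantile of \<open>U\<close> is at most
    \<open>y0 / 2\<close>, hence strictly below \<open>y0\<close>, which leaves room above it where
    \<open>sum_le\<close> applies.\<close>
  have "\<forall>\<^sub>F \<alpha> in at_right 0. \<alpha> \<in> {0<..<measure M {\<omega> \<in> space M. U \<omega> \<le> y0 / 2}}"
    using \<open>0 < y0\<close> by (intro eventually_at_right_real tail) simp
  then show "\<forall>\<^sub>F \<alpha> in at_right 0.
      norm (quantile M ?W \<alpha> - quantile M U \<alpha> * s) \<le> \<epsilon> * norm (quantile M U \<alpha> * s)"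
  proof eventually_elim
    case (elim \<alpha>)
    then have \<alpha>: "0 < \<alpha>" "\<alpha> \<le> measure M {\<omega> \<in> space M. U \<omega> \<le> y0 / 2}"
      by auto
    let ?k = "quantile M U \<alpha>" and ?q = "quantile M ?W \<alpha>"
    have "?k < y0"
      using quantile_le[OF pos(1) \<alpha>] \<open>0 < y0\<close> by linarith
    have "0 \<le> ?k"
      by (rule le_quantile[OF \<alpha>(2)]) (rule less_imp_le[OF mem_quantile_set_pos[OF pos(1) \<alpha>(1)]])
    \<comment> \<open>\<open>sum_le\<close> is used at points \<open>y\<close> strictly above
      \<open>?k\<close>, where the distribution function of \<open>U\<close> has certainly reached
      \<open>\<alpha>\<close>; density of the reals then brings the bound down to
      \<open>?k\<close>.\<close>
    have "?q / ((1 + \<epsilon>) * s) \<le> ?k"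
    proof (rule dense_ge_bounded[OF \<open>?k < y0\<close>])
      fix y assume y: "?k < y" "y < y0"
      have "\<alpha> \<le> measure M {\<omega> \<in> space M. U \<omega> \<le> y}"
        by (rule le_measure_of_quantile_less[OF _ \<alpha>(2) y(1)]) simp
      also have "\<dots> \<le> measure M {\<omega> \<in> space M. ?W \<omega> \<le> (1 + \<epsilon>) * s * y}"
        using y \<open>0 \<le> ?k\<close> by (intro sum_le) auto
      finally have "?q \<le> (1 + \<epsilon>) * s * y"
        by (intro quantile_le[OF Wpos \<alpha>(1)])
      then show "?q / ((1 + \<epsilon>) * s) \<le> y"
        using \<open>0 < \<epsilon>\<close> st by (simp add: pos_divide_le_eq mult_ac)
    qed
    moreover have "0 < (1 + \<epsilon>) * s"
      using \<open>0 < \<epsilon>\<close> st by simp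
    ultimately have "?q \<le> ?k * ((1 + \<epsilon>) * s)"
      by (simp only: pos_divide_le_eq)
    then have upper: "?q \<le> ?k * s + \<epsilon> * (?k * s)"
      by (simp add: algebra_simps)
    have lower: "?k * s \<le> ?q"
    proof (rule le_quantile)
      show "\<alpha> \<le> measure M {\<omega> \<in> space M. ?W \<omega> \<le> (1 + \<epsilon>) * s * (y0 / 2)}"
        using \<alpha>(2) sum_le[of "y0 / 2"] \<open>0 < y0\<close> by simp
    next
      fix y assume "\<alpha> \<le> measure M {\<omega> \<in> space M. ?W \<omega> \<le> y}"
      also have "\<dots> \<le> measure M {\<omega> \<in> space M. U \<omega> \<le> y / s}"
      proof (intro finite_measure_mono)
        have "U \<omega> \<le> y / s" if "\<omega> \<in> space M" "?W \<omega> \<le> y" for \<omega>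
        proof -
          have "0 < t * V \<omega>"
            using pos(2) that(1) st by simp
          then have "s * U \<omega> \<le> y"
            using that(2) by linarith
          then show ?thesis
            using st by (simp add: field_simps)
        qed
        then show "{\<omega> \<in> space M. ?W \<omega> \<le> y} \<subseteq> {\<omega> \<in> space M. U \<omega> \<le> y / s}"
          by auto
      qed measurable
      finally have "?k \<le> y / s"
        by (intro quantile_le[OF pos(1) \<alpha>(1)])
      then show "?k * s \<le> y"
        using st by (simp add: field_simps)
    qed
    show ?case
      using upper lower \<open>0 \<le> ?k\<close> st by simp
  qed
qed

section \<open>Application to the log-normal pair\<close>

theorem mainTheorem5:
  fixes M :: "'a measure"
    and X Z :: "'a \<Rightarrow> real ^ 2"
    and \<mu> :: "real ^ 2"
    and A B :: "real ^ 2 ^ 2"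
    and b :: "2 \<Rightarrow> real"
    and k :: "real \<Rightarrow> real"
    and t\<^sub>1 :: real
  assumes "prob_space M"
    and "pos_def_matrix A"
    and "multivariate_normal M Z \<mu> A"
    and "\<And>\<omega> i. \<omega> \<in> space M \<Longrightarrow> X \<omega> $ i = exp (Z \<omega> $ i)"
    and "B = matrix_inv A"
    and "\<And>i. b i = B $ 1 $ i + B $ 2 $ i"
    and "b 2 < 0"
    and "\<And>\<alpha>. k \<alpha> = sum_quantile M X \<alpha> 1 0"
    and "0 < t\<^sub>1" and "t\<^sub>1 < 1"
  shows "(\<lambda>\<alpha>. sum_quantile M X \<alpha> t\<^sub>1 (1 - t\<^sub>1)) \<sim>[at_right 0] (\<lambda>\<alpha>. k \<alpha> * t\<^sub>1)"
proof -
  have X: "X \<omega> $ i = exp (Z \<omega> $ i)" if "\<omega> \<in> space M" for \<omega> i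
    using assms(4) that .
  have Z: "Z \<in> borel_measurable M"
    using assms(3) distributed_measurable unfolding multivariate_normal_def by fastforce
  have meas: "(\<lambda>\<omega>. X \<omega> $ i) \<in> borel_measurable M" for i
  proof -
    have [measurable]: "(\<lambda>\<omega>. Z \<omega> $ i) \<in> borel_measurable M"
      using measurable_compose[OF Z borel_measurable_nth] .
    have "(\<lambda>\<omega>. exp (Z \<omega> $ i)) \<in> borel_measurable M"
      by measurable
    then show ?thesis
      using X by (simp cong: measurable_cong)
  qed
  have X_le: "X \<omega> $ i \<le> y \<longleftrightarrow> Z \<omega> $ i \<le> ln y" if "\<omega> \<in> space M" "0 < y" for \<omega> i y
    using X that by (simp add: ln_ge_iff)
  \<comment> \<open>Taking logarithms turns the factors \<open>h\<close> and \<open>c\<close> into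
    the shifts \<open>ln h > 0\<close> and \<open>ln c\<close>, and the limit of \<open>y\<close> at
    0 from the right into the limit of \<open>z = ln y\<close> at minus infinity.\<close>
  have dom: "\<forall>\<^sub>F y in at_right 0. measure M {\<omega> \<in> space M. X \<omega> $ 1 \<le> y}
      \<le> measure M {\<omega> \<in> space M. X \<omega> $ 1 \<le> y * h \<and> X \<omega> $ 2 \<le> y * c}"
    if "1 < h" "0 < c" for h c
  proof -
    have "\<forall>\<^sub>F z in at_bot. measure M {\<omega> \<in> space M. Z \<omega> $ 1 \<le> z}
        \<le> measure M {\<omega> \<in> space M. Z \<omega> $ 1 \<le> z + ln h \<and> Z \<omega> $ 2 \<le> z + ln c}"
      using assms that by (intro multivariate_normal_2_lower_tail[OF assms(1-3)]) auto
    then have "\<forall>\<^sub>F y in at_right 0. measure M {\<omega> \<in> space M. Z \<omega> $ 1 \<le> ln y}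
        \<le> measure M {\<omega> \<in> space M. Z \<omega> $ 1 \<le> ln y + ln h \<and> Z \<omega> $ 2 \<le> ln y + ln c}"
      using ln_at_0 by (rule eventually_compose_filterlim)
    with eventually_at_right_less show ?thesis
    proof eventually_elim
      case (elim y)
      have "{\<omega> \<in> space M. X \<omega> $ 1 \<le> y} = {\<omega> \<in> space M. Z \<omega> $ 1 \<le> ln y}"
        and "{\<omega> \<in> space M. X \<omega> $ 1 \<le> y * h \<and> X \<omega> $ 2 \<le> y * c}
          = {\<omega> \<in> space M. Z \<omega> $ 1 \<le> ln y + ln h \<and> Z \<omega> $ 2 \<le> ln y + ln c}"
        using that elim(1) by (auto simp: X_le ln_mult)
      with elim(2) show ?case
        by simp
    qed
  qed
  have tail: "0 < measure M {\<omega> \<in> space M. X \<omega> $ 1 \<le> y}" if "0 < y" for y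
    using multivariate_normal_2_halfspace_pos[OF assms(1-3), of 1 "ln y"] that
    by (simp add: X_le cong: conj_cong)
  show ?thesis
    unfolding assms(8) sum_quantile_def
    using quantile_sum_asymp_equiv[OF assms(1) meas meas _ _ tail dom, of t\<^sub>1 "1 - t\<^sub>1"] X assms(9,10)
    by simp
qed

end
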